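(* Let $(\mathsf X,\mathcal B)$ be a measurable space and let $\mathcal P$ and $\mathcal Q$ be nonempty sets of probability measures on it. Suppose $(\mathcal P,\mathcal Q)$ is sequentially testable. Then there exist sequential tests $(\tau_\alpha)_{\alpha\in(0,1)}$ such that each $\tau_\alpha$ is level-$\alpha$ for $\mathcal P$ and has power one against every $Q\in\mathcal Q$, and such that for every fixed $Q\in\mathcal Q$ there are finite constants $A_Q,B_Q$ satisfying $$\mathbb E_{Q^\infty}\tau_\alpha\le A_Q+B_Q\log(1/\alpha)\qquad\text{for all }0<\alpha<1.$$ In particular, power one can be achieved with finite pointwise expected sample size.
   Context: For a probability measure $R$ on $(\mathsf X,\mathcal B)$, $R^n$ and $R^\infty$ denote i.i.d. product laws on $\mathsf X^n$ and $\mathsf X^{\mathbb N}$; $(X_i)_{i\ge1}$ is the coordinate process and $\mathcal F_n=\sigma(X_1,\dots,X_n)$. A sequential test is an $(\mathcal F_n)$-stopping time $\tau$ with values in $\{1,2,\dots\}\cup\{\infty\}$. It is level-$\alpha$ for $\mathcal P$ if $\sup_{P\in\mathcal P}P^\infty(\tau<\infty)\le\alpha$, and has power one against $Q$ if $Q^\infty(\tau<\infty)=1$. The pair $(\mathcal P,\mathcal Q)$ is called sequentially testable if the following equivalent conditions hold: for some $\alpha\in(0,1)$ there is a level-$\alpha$ test with power one against every $Q\in\mathcal Q$; for every $\alpha\in(0,1)$ there is such a test; there is a countable family $(n_m,h_m)_{m\ge1}$ of bounded measurable $h_m:\mathsf X^{n_m}\to\mathbb R$ with $\sup_{P\in\mathcal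 P}\mathbb E_{P^{n_m}}h_m\le0$ for every $m$ and such that each $Q\in\mathcal Q$ has $\mathbb E_{Q^{n_m}}h_m>0$ for some $m$. *)

theory Defs
  imports "HOL-Probability.Probability"
begin

text \<open>
  The sample space is the measurable space \<open>M\<close> (its measure is irrelevant). Samples are indexed
  from 0, so the coordinate \<open>X\<^sub>i\<close> with \<open>i \<ge> 1\<close> is \<open>\<lambda>\<omega>. \<omega> (i - 1)\<close>.
\<close>

definition iid_pow :: "'a measure \<Rightarrow> nat \<Rightarrow> (nat \<Rightarrow> 'a) measure" where
  "iid_pow R n = Pi\<^sub>M {..<n} (\<lambda>_. R)"

definition iid_inf :: "'a measure \<Rightarrow> (nat \<Rightarrow> 'a) measure" where
  "iid_inf R = Pi\<^sub>M UNIV (\<lambda>_. R)"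

text \<open>
  The \<open>\<sigma>\<close>-algebra generated by the first \<open>t\<close> samples. The time index is \<^typ>\<open>enat\<close>,
  the type of the values of a test, because \<^const>\<open>stopping_time\<close> requires it. The condition
  this adds at \<open>t = \<infinity>\<close> is vacuous, as \<open>\<tau> \<omega> \<le> \<infinity>\<close> always holds.
\<close>

definition sample_filtration :: "'a measure \<Rightarrow> enat \<Rightarrow> (nat \<Rightarrow> 'a) measure" where
  "sample_filtration M t =
     sigma (space (iid_inf M))
       {(\<lambda>\<omega>. \<omega> i) -` A \<inter> space (iid_inf M) | i A. enat i < t \<and> A \<in> sets M}"

lemma filtration_sample_filtration:
  "filtration (space (iid_inf M)) (sample_filtration M)"
proof
  fix s t :: enat
  show "space (sample_filtration M t) = space (iid_inf M)"
    unfolding sample_filtration_def by (rule space_measure_of) auto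
  assume "s \<le> t"
  then show "sets (sample_filtration M s) \<subseteq> sets (sample_filtration M t)"
    unfolding sample_filtration_def
    by (subst (1 2) sets_measure_of)
       (auto intro!: sigma_sets_mono' intro: order_less_le_trans)
qed

definition sequential_test :: "'a measure \<Rightarrow> ((nat \<Rightarrow> 'a) \<Rightarrow> enat) \<Rightarrow> bool" where
  "sequential_test M \<tau> \<longleftrightarrow>
     stopping_time (sample_filtration M) \<tau> \<and> (\<forall>\<omega>\<in>space (iid_inf M). 1 \<le> \<tau> \<omega>)"

definition level :: "'a measure set \<Rightarrow> real \<Rightarrow> ((nat \<Rightarrow> 'a) \<Rightarrow> enat) \<Rightarrow> bool" where
  "level \<P> \<alpha> \<tau> \<longleftrightarrow>
     (\<forall>P\<in>\<P>. measure (iid_inf P) {\<omega>\<in>space (iid_inf P). \<tau> \<omega> < \<infinity>} \<le> \<alpha>)"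

definition power_one :: "'a measure \<Rightarrow> ((nat \<Rightarrow> 'a) \<Rightarrow> enat) \<Rightarrow> bool" where
  "power_one Q \<tau> \<longleftrightarrow> measure (iid_inf Q) {\<omega>\<in>space (iid_inf Q). \<tau> \<omega> < \<infinity>} = 1"

definition has_power_one_test ::
    "'a measure \<Rightarrow> 'a measure set \<Rightarrow> 'a measure set \<Rightarrow> real \<Rightarrow> bool" where
  "has_power_one_test M \<P> \<Q> \<alpha> \<longleftrightarrow>
     (\<exists>\<tau>. sequential_test M \<tau> \<and> level \<P> \<alpha> \<tau> \<and> (\<forall>Q\<in>\<Q>. power_one Q \<tau>))"

definition countably_separated ::
    "'a measure \<Rightarrow> 'a measure set \<Rightarrow> 'a measure set \<Rightarrow> bool" where
  "countably_separated M \<P> \<Q> \<longleftrightarrow>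
     (\<exists>(n :: nat \<Rightarrow> nat) (h :: nat \<Rightarrow> (nat \<Rightarrow> 'a) \<Rightarrow> real).
        (\<forall>m. h m \<in> borel_measurable (iid_pow M (n m)) \<and>
             bounded (h m ` space (iid_pow M (n m)))) \<and>
        (\<forall>m. \<forall>P\<in>\<P>. (\<integral>x. h m x \<partial>iid_pow P (n m)) \<le> 0) \<and>
        (\<forall>Q\<in>\<Q>. \<exists>m. (\<integral>x. h m x \<partial>iid_pow Q (n m)) > 0))"

text \<open>
  Three conditions, known to be equivalent, characterize sequential testability. Taking their
  disjunction means that any one of them suffices to establish it, without presupposing the
  equivalence.
\<close>

definition sequentially_testable ::
    "'a measure \<Rightarrow> 'a measure set \<Rightarrow> 'a measure set \<Rightarrow> bool" where
  "sequentially_testable M \<P> \<Q> \<longleftrightarrow>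
     (\<exists>\<alpha>\<in>{0<..<1}. has_power_one_test M \<P> \<Q> \<alpha>) \<or>
     (\<forall>\<alpha>\<in>{0<..<1}. has_power_one_test M \<P> \<Q> \<alpha>) \<or>
     countably_separated M \<P> \<Q>"

definition expected_sample_size ::
    "'a measure \<Rightarrow> ((nat \<Rightarrow> 'a) \<Rightarrow> enat) \<Rightarrow> ennreal" where
  "expected_sample_size Q \<tau> = (\<integral>\<^sup>+\<omega>. ennreal_of_enat (\<tau> \<omega>) \<partial>iid_inf Q)"

end

theory Submission
  imports Defs
begin

text \<open>
  A power-one test \<open>\<tau>\<close> of level \<open>\<alpha>\<close> yields the separating functions \<open>1{\<tau> \<le> t} - \<alpha>\<close>, so in all
  cases there are countably many bounded \<open>h\<^sub>m\<close> with mean at most 0 under \<open>\<P>\<close> such that each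
  \<open>Q\<close> gives some \<open>h\<^sub>m\<close> a mean above a positive threshold \<open>\<delta>\<^sub>m\<close>. Evaluate \<open>h\<^sub>m\<close> on disjoint blocks
  and reject as soon as, for some \<open>m\<close> and some \<open>k\<close> at least \<open>k\<^sub>m(\<alpha>)\<close>, the sum over the first \<open>k\<close>
  blocks reaches \<open>k \<delta>\<^sub>m\<close>. By Hoeffding's inequality the error probabilities decay geometrically
  in \<open>k\<close>, so a starting index \<open>k\<^sub>m(\<alpha>) = O\<^sub>m(1 + log (1/\<alpha>))\<close> bounds the \<open>m\<close>-th total error by
  \<open>\<alpha> / 2\<^sup>m\<^sup>+\<^sup>1\<close>. Under \<open>Q\<close> the failure probabilities of the right \<open>m\<close> are also geometric, so they
  add only a constant to the expected sample size.
\<close>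

section \<open>Products and the sample filtration\<close>

lemma space_iid_inf_cong: "sets R = sets M \<Longrightarrow> space (iid_inf R) = space (iid_inf M)"
  and sets_iid_inf_cong: "sets R = sets M \<Longrightarrow> sets (iid_inf R) = sets (iid_inf M)"
  and sets_iid_pow_cong: "sets R = sets M \<Longrightarrow> sets (iid_pow R n) = sets (iid_pow M n)"
  by (auto simp: iid_inf_def iid_pow_def intro!: sets_PiM_cong sets_eq_imp_space_eq)

lemma prob_space_iid_inf: "prob_space R \<Longrightarrow> prob_space (iid_inf R)"
  and prob_space_iid_pow: "prob_space R \<Longrightarrow> prob_space (iid_pow R n)"
  unfolding iid_inf_def iid_pow_def by (auto intro: prob_space_PiM)

lemma space_sample_filtration: "space (sample_filtration M t) = space (iid_inf M)"
  using filtration.space_F[OF filtration_sample_filtration] .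

lemma sets_sample_filtration:
  "sets (sample_filtration M t) = sigma_sets (space (iid_inf M))
     {(\<lambda>\<omega>. \<omega> i) -` A \<inter> space (iid_inf M) | i A. enat i < t \<and> A \<in> sets M}"
  unfolding sample_filtration_def by (rule sets_measure_of) auto

lemma measurable_coordinate_sample_filtration:
  "enat i < t \<Longrightarrow> (\<lambda>\<omega>. \<omega> i) \<in> sample_filtration M t \<rightarrow>\<^sub>M M"
  by (rule measurableI)
     (auto simp: space_sample_filtration sets_sample_filtration iid_inf_def space_PiM PiE_iff
           intro: sigma_sets.Basic)

lemma sets_sample_filtration_subset: "sets (sample_filtration M t) \<subseteq> sets (iid_inf M)"
  unfolding sets_sample_filtration
proof (rule sets.sigma_sets_subset, safe)
  fix i A assume "A \<in> sets M"
  moreover have "(\<lambda>\<omega>. \<omega> i) \<in> iid_inf M \<rightarrow>\<^sub>M M"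
    unfolding iid_inf_def by measurable
  ultimately show "(\<lambda>\<omega>. \<omega> i) -` A \<inter> space (iid_inf M) \<in> sets (iid_inf M)"
    by (rule measurable_sets[rotated])
qed

text \<open>Preimages under restriction to the first t coordinates form a sigma-algebra, so it is
  enough that it contains the generating cylinders.\<close>

lemma sets_sample_filtration_enatE:
  assumes "A \<in> sets (sample_filtration M (enat t))"
  obtains B where "B \<in> sets (iid_pow M t)"
    and "A = (\<lambda>\<omega>. restrict \<omega> {..<t}) -` B \<inter> space (iid_inf M)"
proof -
  let ?r = "\<lambda>\<omega>. restrict \<omega> {..<t} :: nat \<Rightarrow> 'a"
  let ?V = "vimage_algebra (space (iid_inf M)) ?r (iid_pow M t)"
  have r: "?r \<in> space (iid_inf M) \<rightarrow> space (iid_pow M t)"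
    by (auto simp: iid_inf_def iid_pow_def space_PiM split: if_splits)
  have V: "sets ?V = {?r -` B \<inter> space (iid_inf M) | B. B \<in> sets (iid_pow M t)}"
    using r by (rule sets_vimage_algebra2)
  have "sigma_sets (space ?V)
      {(\<lambda>\<omega>. \<omega> i) -` A \<inter> space (iid_inf M) | i A. enat i < enat t \<and> A \<in> sets M} \<subseteq> sets ?V"
  proof (rule sets.sigma_sets_subset, safe)
    fix i A assume "enat i < enat t" "A \<in> sets M"
    moreover from this have "(\<lambda>x. x i) -` A \<inter> space (iid_pow M t) \<in> sets (iid_pow M t)"
      unfolding iid_pow_def by (intro measurable_sets[OF measurable_component_singleton]) auto
    moreover have "(\<lambda>\<omega>. \<omega> i) -` A \<inter> space (iid_inf M) =
        ?r -` ((\<lambda>x. x i) -` A \<inter> space (iid_pow M t)) \<inter> space (iid_inf M)"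
      using r \<open>enat i < enat t\<close> by auto
    ultimately show "(\<lambda>\<omega>. \<omega> i) -` A \<inter> space (iid_inf M) \<in> sets ?V"
      unfolding V by blast
  qed
  then have "sets (sample_filtration M (enat t)) \<subseteq> sets ?V"
    by (simp only: sets_sample_filtration space_vimage_algebra)
  with assms V show ?thesis
    using that by blast
qed

text \<open>Applied with the identity to initial segments and with shifted indices to blocks.
  Injectivity ensures that no sample is read twice.\<close>

lemma distr_iid_inf:
  assumes "prob_space R" and "inj_on f {..<n}"
  shows "distr (iid_inf R) (iid_pow R n) (\<lambda>\<omega>. \<lambda>i\<in>{..<n}. \<omega> (f i)) = iid_pow R n"
  using distr_PiM_reindex[of UNIV "\<lambda>_. R" f "{..<n}"] assms
  unfolding iid_inf_def iid_pow_def by simp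

lemma enat_less_infinity_iff: "x < \<infinity> \<longleftrightarrow> (\<exists>t. x \<le> enat t)"
  by (cases x) auto

section \<open>From a power-one test to separating functions\<close>

text \<open>Stopping by time t is no more likely than ever stopping, so its probability is at most
  \<alpha> under \<P>; under Q it increases to 1 and eventually exceeds \<alpha>.\<close>

lemma has_power_one_test_imp_countably_separated:
  assumes P: "\<And>P. P \<in> \<P> \<Longrightarrow> prob_space P \<and> sets P = sets M"
    and Q: "\<And>Q. Q \<in> \<Q> \<Longrightarrow> prob_space Q \<and> sets Q = sets M"
    and "\<alpha> < 1" and "has_power_one_test M \<P> \<Q> \<alpha>"
  shows "countably_separated M \<P> \<Q>"
proof -
  obtain \<tau> where \<tau>: "stopping_time (sample_filtration M) \<tau>" "level \<P> \<alpha> \<tau>"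
      and power: "\<And>Q. Q \<in> \<Q> \<Longrightarrow> power_one Q \<tau>"
    using assms(4) unfolding has_power_one_test_def sequential_test_def by blast
  define S where "S t = {\<omega> \<in> space (iid_inf M). \<tau> \<omega> \<le> enat t}" for t
  have S_filt: "S t \<in> sets (sample_filtration M (enat t))" for t
    using stopping_timeD[OF \<tau>(1), of "enat t"]
    by (simp add: S_def pred_def space_sample_filtration)
  have "\<exists>B. B \<in> sets (iid_pow M t) \<and>
      S t = (\<lambda>\<omega>. restrict \<omega> {..<t}) -` B \<inter> space (iid_inf M)" for t
    by (rule sets_sample_filtration_enatE[OF S_filt[of t]]) blast
  then obtain B where B: "\<And>t. B t \<in> sets (iid_pow M t)"
      "\<And>t. S t = (\<lambda>\<omega>. restrict \<omega> {..<t}) -` B t \<inter> space (iid_inf M)"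
    by metis
  define h :: "nat \<Rightarrow> (nat \<Rightarrow> 'a) \<Rightarrow> real" where "h t x = indicator (B t) x - \<alpha>" for t x
  \<comment> \<open>\<open>S t\<close> is the preimage of \<open>B t\<close> under the projection to
    the first t samples, whose law is \<open>iid_pow R t\<close>; this moves the computation to the
    infinite product.\<close>
  have expectation: "(\<integral>x. h t x \<partial>iid_pow R t) = measure (iid_inf R) (S t) - \<alpha>"
    if R: "prob_space R" "sets R = sets M" for R t
  proof -
    interpret pow: prob_space "iid_pow R t" by (rule prob_space_iid_pow[OF R(1)])
    have BR: "B t \<in> sets (iid_pow R t)"
      using B(1) sets_iid_pow_cong[OF R(2)] by simp
    have "measure (iid_pow R t) (B t) =
        measure (distr (iid_inf R) (iid_pow R t) (\<lambda>\<omega>. restrict \<omega> {..<t})) (B t)"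
      using distr_iid_inf[OF R(1), of "\<lambda>i. i" t] by (simp add: restrict_def)
    also have "\<dots> = measure (iid_inf R) (S t)"
      unfolding B(2)[of t] space_iid_inf_cong[OF R(2), symmetric]
      by (rule measure_distr[OF _ BR])
         (auto simp: iid_inf_def iid_pow_def intro!: measurable_restrict_subset)
    finally show ?thesis
      unfolding h_def using BR sets.sets_into_space[OF BR]
      by (subst Bochner_Integration.integral_diff)
         (auto simp: pow.prob_space pow.emeasure_eq_measure Int_absorb2)
  qed
  have S_sets: "S t \<in> sets (iid_inf R)" if "sets R = sets M" for R t
    using S_filt[of t] sets_sample_filtration_subset[of M "enat t"] sets_iid_inf_cong[OF that] by auto
  have fin: "{\<omega> \<in> space (iid_inf R). \<tau> \<omega> < \<infinity>} = (\<Union>t. S t)" if "sets R = sets M" for R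
    unfolding enat_less_infinity_iff S_def space_iid_inf_cong[OF that] by auto
  show ?thesis
    unfolding countably_separated_def
  proof (intro exI[of _ "\<lambda>t. t"] exI[of _ h] conjI allI ballI)
    show "h t \<in> borel_measurable (iid_pow M t)" for t
      using B(1)[of t] unfolding h_def by measurable
    show "bounded (h t ` space (iid_pow M t))" for t
      unfolding bounded_iff by (rule exI[of _ "1 + \<bar>\<alpha>\<bar>"]) (auto simp: h_def indicator_def)
  next
    fix t P assume "P \<in> \<P>"
    note P = P[OF this]
    then interpret inf: prob_space "iid_inf P" using prob_space_iid_inf by blast
    note S = S_sets[OF P[THEN conjunct2]] and fin = fin[OF P[THEN conjunct2]]
    have "inf.prob (S t) \<le> inf.prob {\<omega> \<in> space (iid_inf P). \<tau> \<omega> < \<infinity>}"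
      using S unfolding fin by (intro inf.finite_measure_mono) auto
    also have "\<dots> \<le> \<alpha>" using \<tau>(2) \<open>P \<in> \<P>\<close> by (auto simp: level_def)
    finally show "(\<integral>x. h t x \<partial>iid_pow P t) \<le> 0" using P by (simp add: expectation)
  next
    fix Q assume "Q \<in> \<Q>"
    note Q = Q[OF this]
    then interpret inf: prob_space "iid_inf Q" using prob_space_iid_inf by blast
    note S = S_sets[OF Q[THEN conjunct2]] and fin = fin[OF Q[THEN conjunct2]]
    have "incseq S"
      by (auto simp: incseq_def S_def intro: order_trans)
    then have "(\<lambda>t. inf.prob (S t)) \<longlonglongrightarrow> 1"
      using inf.finite_Lim_measure_incseq[of S] S power[OF \<open>Q \<in> \<Q>\<close>]
      unfolding power_one_def fin by auto
    then have "\<forall>\<^sub>F t in sequentially. inf.prob (S t) > \<alpha>"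
      using \<open>\<alpha> < 1\<close> by (rule order_tendstoD)
    then obtain t where "inf.prob (S t) > \<alpha>"
      by (auto simp: eventually_sequentially)
    then show "\<exists>t. 0 < (\<integral>x. h t x \<partial>iid_pow Q t)"
      using Q by (auto simp: expectation)
  qed
qed

section \<open>Sums over disjoint blocks\<close>

text \<open>Consecutive blocks start \<open>Suc n\<close> samples apart, so that blocks of length \<open>n = 0\<close> still
  consume samples.\<close>

definition block :: "nat \<Rightarrow> nat \<Rightarrow> (nat \<Rightarrow> 'a) \<Rightarrow> nat \<Rightarrow> 'a" where
  "block n j \<omega> = (\<lambda>i\<in>{..<n}. \<omega> (j * Suc n + i))"

definition block_sum :: "nat \<Rightarrow> ((nat \<Rightarrow> 'a) \<Rightarrow> real) \<Rightarrow> nat \<Rightarrow> (nat \<Rightarrow> 'a) \<Rightarrow> real" where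
  "block_sum n h k \<omega> = (\<Sum>j<k. h (block n j \<omega>))"

lemma block_index_less: "i < n \<Longrightarrow> j < k \<Longrightarrow> j * Suc n + i < k * Suc n"
proof -
  assume "i < n" "j < k"
  then have "j * Suc n + i < Suc j * Suc n" by simp
  also have "\<dots> \<le> k * Suc n" using \<open>j < k\<close> by (intro mult_le_mono1) auto
  finally show ?thesis .
qed

lemma measurable_block:
  assumes "\<And>i. i < n \<Longrightarrow> (\<lambda>\<omega>. \<omega> (j * Suc n + i)) \<in> N \<rightarrow>\<^sub>M M"
  shows "block n j \<in> N \<rightarrow>\<^sub>M iid_pow M n"
  unfolding iid_pow_def block_def using assms by (intro measurable_restrict) auto

lemma measurable_block_iid_inf [measurable]: "block n j \<in> iid_inf M \<rightarrow>\<^sub>M iid_pow M n"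
  by (rule measurable_block) (simp add: iid_inf_def)

text \<open>All coordinates read by the first k blocks lie before \<open>k * Suc n\<close>, so the
  sum is known by then.\<close>

lemma measurable_block_sum_sample_filtration:
  assumes h: "h \<in> borel_measurable (iid_pow M n)" and "enat (k * Suc n) \<le> t"
  shows "block_sum n h k \<in> borel_measurable (sample_filtration M t)"
  unfolding block_sum_def
proof (rule borel_measurable_sum)
  fix j assume "j \<in> {..<k}"
  have "block n j \<in> sample_filtration M t \<rightarrow>\<^sub>M iid_pow M n"
  proof (intro measurable_block measurable_coordinate_sample_filtration)
    fix i assume "i < n"
    then have "enat (j * Suc n + i) < enat (k * Suc n)"
      using block_index_less \<open>j \<in> {..<k}\<close> by (simp del: mult_Suc_right)
    then show "enat (j * Suc n + i) < t"
      using assms(2) by (rule order_less_le_trans)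
  qed
  from measurable_compose[OF this h]
  show "(\<lambda>\<omega>. h (block n j \<omega>)) \<in> borel_measurable (sample_filtration M t)" .
qed

lemma borel_measurable_block_sum:
  assumes [measurable]: "h \<in> borel_measurable (iid_pow R n)"
  shows "block_sum n h k \<in> borel_measurable (iid_inf R)"
  unfolding block_sum_def by measurable

section \<open>Independence of blocks and Hoeffding bounds\<close>

text \<open>The coordinates are independent since their joint law is the product of the marginals.
  Grouping them by disjoint index sets and applying h to each group preserves independence.\<close>

lemma indep_vars_blocks:
  fixes R :: "'a measure"
  assumes R: "prob_space R" and h: "h \<in> borel_measurable (iid_pow R n)"
  shows "prob_space.indep_vars (iid_inf R) (\<lambda>_. borel) (\<lambda>j \<omega>. h (block n j \<omega>)) UNIV"
proof -
  interpret inf: prob_space "iid_inf R" by (rule prob_space_iid_inf[OF R])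
  \<comment> \<open>\<open>K j\<close> is the full stride of length \<open>Suc n\<close>; block j
    reads its first n indices.\<close>
  define K where "K j = {j * Suc n ..< Suc j * Suc n}" for j
  have coord: "inf.indep_vars (\<lambda>_. R) (\<lambda>i \<omega>. \<omega> i) UNIV"
  proof (subst inf.indep_vars_iff_distr_eq_PiM)
    show "(\<lambda>\<omega>. \<omega> i) \<in> iid_inf R \<rightarrow>\<^sub>M R" for i by (simp add: iid_inf_def)
    show "distr (iid_inf R) (Pi\<^sub>M UNIV (\<lambda>_. R)) (\<lambda>x. \<lambda>i\<in>UNIV. x i) =
        Pi\<^sub>M UNIV (\<lambda>i. distr (iid_inf R) R (\<lambda>\<omega>. \<omega> i))"
      using R unfolding iid_inf_def by (subst distr_PiM_component) (auto simp: restrict_UNIV distr_id)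
  qed auto
  have disj: "disjoint_family K"
    unfolding disjoint_family_on_def
  proof (safe, goal_cases)
    case (1 a b x)
    \<comment> \<open>A common point gives \<open>a * Suc n < Suc b * Suc n\<close> and the same
      with a and b exchanged, which forces a = b.\<close>
    then have "a < Suc b" "b < Suc a"
      unfolding K_def by (auto dest: order_le_less_trans simp del: mult_Suc mult_Suc_right)
    with 1 show ?case by simp
  qed
  have "inf.indep_vars (\<lambda>j. Pi\<^sub>M (K j) (\<lambda>_. R)) (\<lambda>j \<omega>. restrict \<omega> (K j)) UNIV"
    using inf.indep_vars_restrict[OF coord _ disj] by simp
  then have "inf.indep_vars (\<lambda>_. borel)
      (\<lambda>j \<omega>. h (\<lambda>i\<in>{..<n}. restrict \<omega> (K j) (j * Suc n + i))) UNIV"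
  proof (rule inf.indep_vars_compose2)
    show "(\<lambda>x. h (\<lambda>i\<in>{..<n}. x (j * Suc n + i))) \<in> borel_measurable (Pi\<^sub>M (K j) (\<lambda>_. R))" for j
      by (rule measurable_compose[OF _ h], unfold iid_pow_def, rule measurable_restrict,
          rule measurable_component_singleton) (auto simp: K_def)
  qed
  moreover have "(\<lambda>i\<in>{..<n}. restrict \<omega> (K j) (j * Suc n + i)) = block n j \<omega>"
    for j and \<omega> :: "nat \<Rightarrow> 'a"
    by (auto simp: K_def block_def fun_eq_iff)
  ultimately show ?thesis by (simp only:)
qed

lemma distr_block:
  assumes "prob_space R"
  shows "distr (iid_inf R) (iid_pow R n) (block n j) = iid_pow R n"
  using distr_iid_inf[OF assms, of "\<lambda>i. j * Suc n + i" n] by (simp add: block_def[abs_def] inj_on_def)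

text \<open>Hoeffding's inequality for i.i.d. values in [-C, C], with \<epsilon> a lower bound on
  the gap from the mean up to the slope \<mu>. The exponent is
  \<open>2 * k * \<epsilon>\<^sup>2 / (2 * C)\<^sup>2\<close>.\<close>

lemma block_sum_ge_bound:
  assumes R: "prob_space R" and h: "h \<in> borel_measurable (iid_pow R n)"
    and C: "\<And>x. x \<in> space (iid_pow R n) \<Longrightarrow> \<bar>h x\<bar> \<le> C" "0 < C" and "0 \<le> \<epsilon>"
    and \<mu>: "(\<integral>x. h x \<partial>iid_pow R n) + \<epsilon> \<le> \<mu>"
  shows "measure (iid_inf R) {\<omega>\<in>space (iid_inf R). real k * \<mu> \<le> block_sum n h k \<omega>}
    \<le> exp (- (real k * (\<epsilon>\<^sup>2 / (2 * C\<^sup>2))))"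
proof (cases "k = 0")
  \<comment> \<open>Without blocks there is no average to estimate, but the bound is
    \<open>exp 0 = 1\<close>.\<close>
  case True
  interpret inf: prob_space "iid_inf R" by (rule prob_space_iid_inf[OF R])
  show ?thesis using True by simp
next
  case False
  note [measurable] = h
  interpret inf: prob_space "iid_inf R" by (rule prob_space_iid_inf[OF R])
  have distr: "distr (iid_inf R) borel (\<lambda>\<omega>. h (block n j \<omega>)) = distr (iid_pow R n) borel h" for j
    using distr_distr[OF h measurable_block_iid_inf[of n j R]] distr_block[OF R, of n j]
    by (simp add: comp_def)
  interpret H: Hoeffding_ineq_iid "iid_inf R" "{..<k}" "\<lambda>j \<omega>. h (block n j \<omega>)"
      "\<lambda>\<omega>. h (block n 0 \<omega>)" "- C" C "inf.expectation (\<lambda>\<omega>. h (block n 0 \<omega>))"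
  proof unfold_locales
    show "inf.indep_vars (\<lambda>_. borel) (\<lambda>j \<omega>. h (block n j \<omega>)) {..<k}"
      by (rule inf.indep_vars_subset[OF indep_vars_blocks[OF R h]]) simp
    show "AE \<omega> in iid_inf R. h (block n 0 \<omega>) \<in> {- C..C}"
    proof (rule AE_I2)
      fix \<omega> assume "\<omega> \<in> space (iid_inf R)"
      then have "\<bar>h (block n 0 \<omega>)\<bar> \<le> C"
        by (intro C(1) measurable_space[OF measurable_block_iid_inf])
      then show "h (block n 0 \<omega>) \<in> {- C..C}" by auto
    qed
  qed (simp_all add: distr)
  have mean: "inf.expectation (\<lambda>\<omega>. h (block n 0 \<omega>)) = (\<integral>x. h x \<partial>iid_pow R n)"
    using integral_distr[OF measurable_block_iid_inf[of n 0 R] h] distr_block[OF R, of n 0] by simp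
  have "inf.prob {\<omega>\<in>space (iid_inf R). real k * \<mu> \<le> block_sum n h k \<omega>} \<le>
      inf.prob {\<omega>\<in>space (iid_inf R).
        (\<Sum>j<k. h (block n j \<omega>)) / real k \<ge> (\<integral>x. h x \<partial>iid_pow R n) + \<epsilon>}"
  proof (rule inf.finite_measure_mono)
    have "real k * ((\<integral>x. h x \<partial>iid_pow R n) + \<epsilon>) \<le> real k * \<mu>"
      using \<mu> by (intro mult_left_mono) auto
    from order_trans[OF this] show "{\<omega>\<in>space (iid_inf R). real k * \<mu> \<le> block_sum n h k \<omega>} \<subseteq>
      {\<omega>\<in>space (iid_inf R).
        (\<Sum>j<k. h (block n j \<omega>)) / real k \<ge> (\<integral>x. h x \<partial>iid_pow R n) + \<epsilon>}"
      using False by (auto simp: block_sum_def pos_le_divide_eq mult.commute[of _ "real k"])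
  qed measurable
  also have "\<dots> \<le> exp (- 2 * real k * \<epsilon>\<^sup>2 / (C - - C)\<^sup>2)"
    using H.Hoeffding_ineq_ge'[OF \<open>0 \<le> \<epsilon>\<close>] False C(2) by (simp add: mean lessThan_empty_iff)
  also have "- 2 * real k * \<epsilon>\<^sup>2 / (C - - C)\<^sup>2 = - (real k * (\<epsilon>\<^sup>2 / (2 * C\<^sup>2)))"
    using C(2) by (simp add: field_simps power2_eq_square)
  finally show ?thesis .
qed

text \<open>This is the upper tail bound for \<open>- h\<close> with slope
  \<open>- \<mu>\<close>.\<close>

lemma block_sum_less_bound:
  assumes R: "prob_space R" and h: "h \<in> borel_measurable (iid_pow R n)"
    and C: "\<And>x. x \<in> space (iid_pow R n) \<Longrightarrow> \<bar>h x\<bar> \<le> C" "0 < C" and "0 \<le> \<epsilon>"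
    and \<mu>: "\<mu> + \<epsilon> \<le> (\<integral>x. h x \<partial>iid_pow R n)"
  shows "measure (iid_inf R) {\<omega>\<in>space (iid_inf R). block_sum n h k \<omega> < real k * \<mu>}
    \<le> exp (- (real k * (\<epsilon>\<^sup>2 / (2 * C\<^sup>2))))"
proof -
  note [measurable] = h
  interpret inf: prob_space "iid_inf R" by (rule prob_space_iid_inf[OF R])
  have [measurable]: "block_sum n (\<lambda>x. - h x) k \<in> borel_measurable (iid_inf R)"
    by (rule borel_measurable_block_sum) measurable
  have "inf.prob {\<omega>\<in>space (iid_inf R). block_sum n h k \<omega> < real k * \<mu>}
      \<le> inf.prob {\<omega>\<in>space (iid_inf R). real k * (- \<mu>) \<le> block_sum n (\<lambda>x. - h x) k \<omega>}"
    by (rule inf.finite_measure_mono) (auto simp: block_sum_def sum_negf)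
  also have "\<dots> \<le> exp (- (real k * (\<epsilon>\<^sup>2 / (2 * C\<^sup>2))))"
    using assms by (intro block_sum_ge_bound) auto
  finally show ?thesis .
qed

text \<open>Adds up the Hoeffding bounds over all block counts from s on: a geometric series with
  ratio \<open>exp (- r)\<close>.\<close>

lemma suminf_exp_tail:
  fixes r :: real
  assumes "0 < r"
  shows "(\<Sum>i. ennreal (exp (- (real (s + i) * r)))) = ennreal (exp (- (real s * r)) / (1 - exp (- r)))"
proof (rule suminf_ennreal_eq)
  have "(\<lambda>i. exp (- (real s * r)) * exp (- r) ^ i) sums (exp (- (real s * r)) * (1 / (1 - exp (- r))))"
    using assms by (intro sums_mult geometric_sums) auto
  moreover have "exp (- (real s * r)) * exp (- r) ^ i = exp (- (real (s + i) * r))" for i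
    by (simp add: exp_of_nat_mult[symmetric] exp_add[symmetric] algebra_simps)
  ultimately show "(\<lambda>i. exp (- (real (s + i) * r))) sums (exp (- (real s * r)) / (1 - exp (- r)))"
    by simp
qed simp

section \<open>The sequential test of a separating family\<close>

text \<open>The test is built from these data alone, without reference to a law, so that one test
  serves all of \<P> and \<Q>. \<open>\<delta> m\<close> is the slope of the m-th rejection
  boundary.\<close>

locale separating_family =
  fixes M :: "'a measure" and n :: "nat \<Rightarrow> nat" and h :: "nat \<Rightarrow> (nat \<Rightarrow> 'a) \<Rightarrow> real"
    and C \<delta> :: "nat \<Rightarrow> real"
  assumes h_measurable: "h m \<in> borel_measurable (iid_pow M (n m))"
    and h_bounded: "x \<in> space (iid_pow M (n m)) \<Longrightarrow> \<bar>h m x\<bar> \<le> C m"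
    and C_pos: "0 < C m"
    and \<delta>_pos: "0 < \<delta> m"
begin

text \<open>The Hoeffding exponent per block when the mean is at most 0 and the boundary has slope
  \<open>\<delta> m\<close>.\<close>

definition rate :: "nat \<Rightarrow> real" where
  "rate m = (\<delta> m)\<^sup>2 / (2 * (C m)\<^sup>2)"

text \<open>Chosen so that \<open>exp (- offset m)\<close> cancels the geometric series factor
  \<open>1 / (1 - exp (- rate m))\<close> and leaves the weight
  \<open>(1 / 2) ^ Suc m\<close>.\<close>

definition offset :: "nat \<Rightarrow> real" where
  "offset m = ln (2 ^ Suc m / (1 - exp (- rate m)))"

text \<open>The \<open>Suc\<close> keeps the index positive, so that the test cannot stop at time
  0.\<close>

definition start :: "real \<Rightarrow> nat \<Rightarrow> nat" where
  "start \<alpha> m = Suc (nat \<lceil>(ln (1 / \<alpha>) + offset m) / rate m\<rceil>)"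

definition passes :: "nat \<Rightarrow> nat \<Rightarrow> (nat \<Rightarrow> 'a) \<Rightarrow> bool" where
  "passes m k \<omega> \<longleftrightarrow> real k * \<delta> m \<le> block_sum (n m) (h m) k \<omega>"

text \<open>The check of criterion m on k blocks takes place at time \<open>k * Suc (n m)\<close>.
  If no check succeeds, the infimum of the empty set gives \<infinity>.\<close>

definition test :: "real \<Rightarrow> (nat \<Rightarrow> 'a) \<Rightarrow> enat" where
  "test \<alpha> \<omega> = Inf {enat (k * Suc (n m)) | m k. start \<alpha> m \<le> k \<and> passes m k \<omega>}"

section \<open>Calibration of the starting indices\<close>

lemma rate_pos: "0 < rate m"
  using C_pos[of m] \<delta>_pos[of m] by (simp add: rate_def)

lemma offset_nonneg: "0 \<le> offset m"
proof -
  have "1 - exp (- rate m) \<le> 2 ^ Suc m"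
    by (rule order_trans[of _ 1]) (auto intro: one_le_power simp del: power_Suc)
  then show ?thesis
    using rate_pos[of m] unfolding offset_def by (intro ln_ge_zero) (auto simp: le_divide_eq)
qed

lemma start_le:
  assumes "0 < \<alpha>" "\<alpha> < 1"
  shows "real (start \<alpha> m) \<le> 2 + offset m / rate m + 1 / rate m * ln (1 / \<alpha>)"
proof -
  \<comment> \<open>Nonnegativity makes \<open>nat\<close> harmless; rounding up and
    \<open>Suc\<close> then cost at most 1 each, hence the 2.\<close>
  have "0 \<le> (ln (1 / \<alpha>) + offset m) / rate m"
    using assms rate_pos[of m] offset_nonneg[of m]
    by (intro divide_nonneg_pos add_nonneg_nonneg) auto
  then have "real (start \<alpha> m) \<le> 2 + (ln (1 / \<alpha>) + offset m) / rate m"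
    unfolding start_def by linarith
  then show ?thesis by (simp add: add_divide_distrib)
qed

text \<open>By \<open>suminf_exp_tail\<close> the left side is the sum of the error bounds over all
  checks of criterion m. \<open>start\<close> makes the exponent at least
  \<open>ln (1 / \<alpha>) + offset m\<close>, and the weights on the right add up to \<alpha> over
  m.\<close>

lemma exp_start_le:
  assumes "0 < \<alpha>"
  shows "exp (- (real (start \<alpha> m) * rate m)) / (1 - exp (- rate m)) \<le> \<alpha> * (1 / 2) ^ Suc m"
proof -
  have *: "0 < 1 - exp (- rate m)" using rate_pos[of m] by simp
  have "(ln (1 / \<alpha>) + offset m) / rate m \<le> real (start \<alpha> m)"
    unfolding start_def by linarith
  then have "ln (1 / \<alpha>) + offset m \<le> real (start \<alpha> m) * rate m"
    using rate_pos[of m] by (simp add: divide_le_eq)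
  then have "exp (- (real (start \<alpha> m) * rate m)) \<le> exp (- (ln (1 / \<alpha>) + offset m))"
    by simp
  also have "\<dots> = \<alpha> * ((1 / 2) ^ Suc m * (1 - exp (- rate m)))"
  proof -
    define q where "q = 1 - exp (- rate m)"
    have "exp (offset m) = 2 ^ Suc m / q" "exp (ln (1 / \<alpha>)) = 1 / \<alpha>"
      using assms * by (simp_all add: offset_def q_def)
    then have "exp (- (ln (1 / \<alpha>) + offset m)) = inverse (1 / \<alpha> * (2 ^ Suc m / q))"
      by (simp only: exp_minus exp_add)
    then show ?thesis
      unfolding q_def[symmetric] by (simp add: power_divide)
  qed
  finally show ?thesis using * by (simp add: divide_le_eq mult.assoc)
qed

section \<open>The stopping property\<close>

text \<open>A finite infimum comes from a nonempty set of extended naturals, and such a set contains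
  its infimum by well-ordering.\<close>

lemma test_le_enat_iff:
  "test \<alpha> \<omega> \<le> enat t \<longleftrightarrow> (\<exists>m k. start \<alpha> m \<le> k \<and> passes m k \<omega> \<and> k * Suc (n m) \<le> t)"
    (is "?L \<longleftrightarrow> ?R")
proof
  let ?A = "{enat (k * Suc (n m)) | m k. start \<alpha> m \<le> k \<and> passes m k \<omega>}"
  assume L: ?L
  have "?A \<noteq> {}"
  proof
    assume "?A = {}"
    with L show False unfolding test_def by (simp only: Inf_empty) (simp add: top_enat_def)
  qed
  then obtain a where "a \<in> ?A" by blast
  then have "(LEAST x. x \<in> ?A) \<in> ?A" by (rule LeastI)
  then have "test \<alpha> \<omega> \<in> ?A"
    unfolding test_def Inf_enat_def using \<open>?A \<noteq> {}\<close> by (simp only: if_False)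
  then obtain m k where "test \<alpha> \<omega> = enat (k * Suc (n m))" "start \<alpha> m \<le> k" "passes m k \<omega>"
    by blast
  with L show ?R by (metis enat_ord_simps(1))
next
  assume ?R
  then show ?L
    unfolding test_def by (auto simp del: mult_Suc_right intro!: Inf_lower2)
qed

lemma test_finite_iff: "test \<alpha> \<omega> < \<infinity> \<longleftrightarrow> (\<exists>m i. passes m (start \<alpha> m + i) \<omega>)"
proof -
  have "test \<alpha> \<omega> < \<infinity> \<longleftrightarrow> (\<exists>t. test \<alpha> \<omega> \<le> enat t)"
    by (rule enat_less_infinity_iff)
  also have "\<dots> \<longleftrightarrow> (\<exists>m k. start \<alpha> m \<le> k \<and> passes m k \<omega>)"
    unfolding test_le_enat_iff by blast
  finally show ?thesis by (metis le_add1 le_Suc_ex)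
qed

text \<open>Stopping by a finite time is a countable union of events, each decided by a check held
  no later than that time and hence by samples already seen. Later checks contribute a constantly
  false predicate.\<close>

lemma sequential_test_test: "sequential_test M (test \<alpha>)"
  unfolding sequential_test_def
proof (intro conjI stopping_timeI ballI)
  show "Measurable.pred (sample_filtration M t) (\<lambda>\<omega>. test \<alpha> \<omega> \<le> t)" for t
  proof (cases t)
    case (enat t')
    have "Measurable.pred (sample_filtration M t)
        (\<lambda>\<omega>. start \<alpha> m \<le> k \<and> passes m k \<omega> \<and> k * Suc (n m) \<le> t')" for m k
    proof (cases "k * Suc (n m) \<le> t'")
      case True
      then have [measurable]: "block_sum (n m) (h m) k \<in> borel_measurable (sample_filtration M t)"
        using h_measurable enat by (intro measurable_block_sum_sample_filtration) auto
      show ?thesis unfolding passes_def by measurable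
    qed simp
    then show ?thesis unfolding enat test_le_enat_iff by (intro pred_intros_countable)
  qed simp
  show "1 \<le> test \<alpha> \<omega>" for \<omega>
    unfolding test_def by (intro Inf_greatest) (auto simp: start_def one_enat_def)
qed

section \<open>Error level and expected sample size under a fixed law\<close>

context
  fixes R :: "'a measure"
  assumes R: "prob_space R" "sets R = sets M"
begin

lemma h_measurable_R: "h m \<in> borel_measurable (iid_pow R (n m))"
  using h_measurable measurable_cong_sets[OF sets_iid_pow_cong[OF R(2)] refl] by blast

lemma h_bounded_R: "x \<in> space (iid_pow R (n m)) \<Longrightarrow> \<bar>h m x\<bar> \<le> C m"
  using h_bounded sets_eq_imp_space_eq[OF sets_iid_pow_cong[OF R(2)]] by blast

lemma pred_passes [measurable]: "Measurable.pred (iid_inf R) (passes m k)"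
  unfolding passes_def using borel_measurable_block_sum[OF h_measurable_R] by measurable

text \<open>A union bound over all criteria and checks. Since the means are at most 0, the Hoeffding
  gap is \<open>\<delta> m\<close>, and criterion m costs at most
  \<open>\<alpha> / 2 ^ Suc m\<close>.\<close>

lemma test_level:
  assumes mean: "\<And>m. (\<integral>x. h m x \<partial>iid_pow R (n m)) \<le> 0" and "0 < \<alpha>"
  shows "measure (iid_inf R) {\<omega>\<in>space (iid_inf R). test \<alpha> \<omega> < \<infinity>} \<le> \<alpha>"
proof -
  interpret inf: prob_space "iid_inf R" by (rule prob_space_iid_inf[OF R(1)])
  define E where "E m i = {\<omega>\<in>space (iid_inf R). passes m (start \<alpha> m + i) \<omega>}" for m i
  have E_sets [measurable]: "E m i \<in> sets (iid_inf R)" for m i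
    unfolding E_def by measurable
  have E_bound: "emeasure (iid_inf R) (E m i) \<le> ennreal (exp (- (real (start \<alpha> m + i) * rate m)))" for m i
    unfolding inf.emeasure_eq_measure E_def passes_def rate_def
    using mean \<delta>_pos[of m]
    by (intro ennreal_leI block_sum_ge_bound[OF R(1) h_measurable_R h_bounded_R C_pos]) (auto intro: less_imp_le)
  have "emeasure (iid_inf R) {\<omega>\<in>space (iid_inf R). test \<alpha> \<omega> < \<infinity>} = emeasure (iid_inf R) (\<Union>m. \<Union>i. E m i)"
    unfolding test_finite_iff E_def by (rule arg_cong[where f = "emeasure _"]) auto
  also have "\<dots> \<le> (\<Sum>m. emeasure (iid_inf R) (\<Union>i. E m i))"
    by (rule emeasure_subadditive_countably) auto
  also have "\<dots> \<le> (\<Sum>m. ennreal (\<alpha> * (1 / 2) ^ Suc m))"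
  proof (rule suminf_le)
    fix m
    have "emeasure (iid_inf R) (\<Union>i. E m i) \<le> (\<Sum>i. emeasure (iid_inf R) (E m i))"
      by (rule emeasure_subadditive_countably) auto
    also have "\<dots> \<le> (\<Sum>i. ennreal (exp (- (real (start \<alpha> m + i) * rate m))))"
      by (intro suminf_le E_bound) auto
    also have "\<dots> \<le> ennreal (\<alpha> * (1 / 2) ^ Suc m)"
      unfolding suminf_exp_tail[OF rate_pos] by (intro ennreal_leI exp_start_le \<open>0 < \<alpha>\<close>)
    finally show "emeasure (iid_inf R) (\<Union>i. E m i) \<le> ennreal (\<alpha> * (1 / 2) ^ Suc m)" .
  qed auto
  also have "\<dots> = ennreal (\<alpha> * 1)"
    using \<open>0 < \<alpha>\<close> by (intro suminf_ennreal_eq sums_mult power_half_series) auto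
  finally show ?thesis
    using \<open>0 < \<alpha>\<close> by (simp add: inf.emeasure_eq_measure)
qed

text \<open>The number of blocks used is at most \<open>start \<alpha> m\<close> plus the number of later failures of the
  \<open>m\<close>-th criterion, and the failure probabilities are summable.\<close>

lemma test_le_failures:
  "ennreal_of_enat (test \<alpha> \<omega>) \<le> ennreal (real (Suc (n m))) *
     (ennreal (real (start \<alpha> m)) + (\<Sum>i. indicator {\<omega>. \<not> passes m (start \<alpha> m + i) \<omega>} \<omega>))"
proof (cases "\<exists>i. passes m (start \<alpha> m + i) \<omega>")
  case True
  define i where "i = (LEAST i. passes m (start \<alpha> m + i) \<omega>)"
  have i: "passes m (start \<alpha> m + i) \<omega>"
    unfolding i_def using True by (rule LeastI_ex)
  have "test \<alpha> \<omega> \<le> enat ((start \<alpha> m + i) * Suc (n m))"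
    unfolding test_le_enat_iff using i by (intro exI[of _ m] exI[of _ "start \<alpha> m + i"]) auto
  then have "ennreal_of_enat (test \<alpha> \<omega>) \<le> ennreal_of_enat (enat ((start \<alpha> m + i) * Suc (n m)))"
    by (simp only: ennreal_of_enat_le_iff)
  also have "\<dots> = ennreal (real (Suc (n m))) * (ennreal (real (start \<alpha> m)) + ennreal (real i))"
    by (simp only: ennreal_of_enat_enat ennreal_of_nat_eq_real_of_nat of_nat_mult of_nat_add
        ennreal_plus[symmetric] ennreal_mult[symmetric] of_nat_0_le_iff add_nonneg_nonneg mult.commute)
  finally have le: "ennreal_of_enat (test \<alpha> \<omega>) \<le>
      ennreal (real (Suc (n m))) * (ennreal (real (start \<alpha> m)) + ennreal (real i))" .
  \<comment> \<open>Minimality of i makes the first i indicators equal to 1.\<close>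
  have "ennreal (real i) = (\<Sum>j<i. indicator {\<omega>. \<not> passes m (start \<alpha> m + j) \<omega>} \<omega>)"
    using not_less_Least[of _ "\<lambda>i. passes m (start \<alpha> m + i) \<omega>", folded i_def]
    by (simp add: ennreal_of_nat_eq_real_of_nat)
  also have "\<dots> \<le> (\<Sum>i. indicator {\<omega>. \<not> passes m (start \<alpha> m + i) \<omega>} \<omega>)"
    by (rule sum_le_suminf) auto
  finally show ?thesis
    by (intro order_trans[OF le] mult_left_mono add_left_mono) auto
next
  case False
  \<comment> \<open>If no check succeeds, the series diverges, and the bound is infinite since
    \<open>Suc (n m)\<close> is positive.\<close>
  then have "(\<Sum>i. indicator {\<omega>. \<not> passes m (start \<alpha> m + i) \<omega>} \<omega> :: ennreal) = \<top>"
    by (simp add: suminf_eq_SUP ennreal_SUP_of_nat_eq_top)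
  then show ?thesis by (simp add: ennreal_mult_top)
qed

text \<open>Integrating \<open>test_le_failures\<close> leaves a sum of failure probabilities, which
  is bounded by a geometric series uniformly in \<alpha>; only \<open>start \<alpha> m\<close> still
  depends on \<alpha>.\<close>

lemma expected_sample_size_test_le:
  assumes "\<delta> m < (\<integral>x. h m x \<partial>iid_pow R (n m))"
  obtains K :: real where "\<And>\<alpha>. expected_sample_size R (test \<alpha>) \<le>
    ennreal (real (Suc (n m)) * (real (start \<alpha> m) + K))"
proof
  interpret inf: prob_space "iid_inf R" by (rule prob_space_iid_inf[OF R(1)])
  \<comment> \<open>The gap between the mean under R and the boundary slope; r is the resulting
    Hoeffding exponent for failures, in general different from \<open>rate m\<close>.\<close>
  define \<epsilon> where "\<epsilon> = (\<integral>x. h m x \<partial>iid_pow R (n m)) - \<delta> m"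
  define r where "r = \<epsilon>\<^sup>2 / (2 * (C m)\<^sup>2)"
  have "0 < \<epsilon>" "0 < r" using assms C_pos[of m] by (auto simp: \<epsilon>_def r_def)
  fix \<alpha>
  let ?F = "\<lambda>i \<omega>. indicator {\<omega>. \<not> passes m (start \<alpha> m + i) \<omega>} \<omega> :: ennreal"
  have F [measurable]: "?F i \<in> borel_measurable (iid_inf R)" for i
    by measurable
  have "(\<integral>\<^sup>+\<omega>. ?F i \<omega> \<partial>iid_inf R) \<le> ennreal (exp (- (real (start \<alpha> m + i) * r)))" for i
  proof -
    have "(\<integral>\<^sup>+\<omega>. ?F i \<omega> \<partial>iid_inf R) =
        (\<integral>\<^sup>+\<omega>. indicator {\<omega>\<in>space (iid_inf R). \<not> passes m (start \<alpha> m + i) \<omega>} \<omega> \<partial>iid_inf R)"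
      by (rule nn_integral_cong) (auto simp: indicator_def)
    also have "\<dots> = emeasure (iid_inf R) {\<omega>\<in>space (iid_inf R). \<not> passes m (start \<alpha> m + i) \<omega>}"
      by (rule nn_integral_indicator) measurable
    also have "\<dots> \<le> ennreal (exp (- (real (start \<alpha> m + i) * r)))"
      unfolding inf.emeasure_eq_measure passes_def not_le r_def
      using \<open>0 < \<epsilon>\<close>
      by (intro ennreal_leI block_sum_less_bound[OF R(1) h_measurable_R h_bounded_R C_pos])
         (auto simp: \<epsilon>_def)
    finally show ?thesis .
  qed
  then have "(\<Sum>i. \<integral>\<^sup>+\<omega>. ?F i \<omega> \<partial>iid_inf R) \<le>
      (\<Sum>i. ennreal (exp (- (real (start \<alpha> m + i) * r))))"
    by (intro suminf_le) auto
  \<comment> \<open>The factor \<open>exp (- (real (start \<alpha> m) * r))\<close> is at most 1;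
    dropping it removes the dependence on \<alpha>.\<close>
  also have "\<dots> \<le> ennreal (1 / (1 - exp (- r)))"
    unfolding suminf_exp_tail[OF \<open>0 < r\<close>] using \<open>0 < r\<close>
    by (intro ennreal_leI divide_right_mono) auto
  finally have tail: "(\<Sum>i. \<integral>\<^sup>+\<omega>. ?F i \<omega> \<partial>iid_inf R) \<le> ennreal (1 / (1 - exp (- r)))" .
  have "expected_sample_size R (test \<alpha>) \<le>
      (\<integral>\<^sup>+\<omega>. ennreal (real (Suc (n m))) * (ennreal (real (start \<alpha> m)) + (\<Sum>i. ?F i \<omega>)) \<partial>iid_inf R)"
    unfolding expected_sample_size_def by (intro nn_integral_mono test_le_failures)
  also have "\<dots> = ennreal (real (Suc (n m))) *
      (ennreal (real (start \<alpha> m)) + (\<Sum>i. \<integral>\<^sup>+\<omega>. ?F i \<omega> \<partial>iid_inf R))"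
    by (subst nn_integral_cmult, measurable, subst nn_integral_add, simp, measurable,
        subst nn_integral_suminf, measurable) (simp add: inf.emeasure_space_1)
  also have "\<dots> \<le> ennreal (real (Suc (n m))) *
      (ennreal (real (start \<alpha> m)) + ennreal (1 / (1 - exp (- r))))"
    by (intro mult_left_mono add_left_mono tail) auto
  also have "\<dots> = ennreal (real (Suc (n m)) * (real (start \<alpha> m) + 1 / (1 - exp (- r))))"
    using \<open>0 < r\<close> by (subst ennreal_plus[symmetric], simp, simp, subst ennreal_mult) auto
  finally show "expected_sample_size R (test \<alpha>) \<le>
      ennreal (real (Suc (n m)) * (real (start \<alpha> m) + 1 / (1 - exp (- r))))" .
qed

text \<open>\<alpha> enters only through \<open>start\<close>, which \<open>start_le\<close> bounds
  affinely in \<open>ln (1 / \<alpha>)\<close>. The coefficient of the logarithm is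
  \<open>Suc (n m) / rate m\<close>.\<close>

lemma expected_sample_size_test_log:
  assumes "\<delta> m < (\<integral>x. h m x \<partial>iid_pow R (n m))"
  shows "\<exists>A B :: real. \<forall>\<alpha>\<in>{0<..<1}.
    expected_sample_size R (test \<alpha>) \<le> ennreal (A + B * ln (1 / \<alpha>))"
proof -
  obtain K where K: "\<And>\<alpha>. expected_sample_size R (test \<alpha>) \<le>
      ennreal (real (Suc (n m)) * (real (start \<alpha> m) + K))"
    using expected_sample_size_test_le[OF assms] by blast
  let ?N = "real (Suc (n m))"
  have "expected_sample_size R (test \<alpha>) \<le>
      ennreal (?N * (2 + offset m / rate m + K) + ?N / rate m * ln (1 / \<alpha>))"
    if \<alpha>: "\<alpha> \<in> {0<..<1}" for \<alpha>
  proof -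
    have "?N * (real (start \<alpha> m) + K) \<le>
        ?N * (2 + offset m / rate m + 1 / rate m * ln (1 / \<alpha>) + K)"
      using start_le[of \<alpha> m] \<alpha> by (intro mult_left_mono) auto
    also have "\<dots> = ?N * (2 + offset m / rate m + K) + ?N / rate m * ln (1 / \<alpha>)"
      by (simp add: algebra_simps)
    finally show ?thesis
      using K[of \<alpha>] by (rule order_trans[rotated, OF ennreal_leI])
  qed
  then show ?thesis by blast
qed

text \<open>A positive probability of never stopping would make the expectation infinite.\<close>

lemma power_one_test:
  assumes "expected_sample_size R (test \<alpha>) < \<infinity>"
  shows "power_one R (test \<alpha>)"
proof -
  interpret inf: prob_space "iid_inf R" by (rule prob_space_iid_inf[OF R(1)])
  have test_measurable: "{\<omega>\<in>space (iid_inf R). test \<alpha> \<omega> < \<infinity>} \<in> sets (iid_inf R)"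
    unfolding test_finite_iff by measurable
  have "top * emeasure (iid_inf R) {\<omega>\<in>space (iid_inf R). \<not> test \<alpha> \<omega> < \<infinity>} =
      (\<integral>\<^sup>+\<omega>. top * indicator {\<omega>\<in>space (iid_inf R). \<not> test \<alpha> \<omega> < \<infinity>} \<omega> \<partial>iid_inf R)"
    using test_measurable by (intro nn_integral_cmult_indicator[symmetric] sets.sets_Collect_neg) 
  also have "\<dots> \<le> expected_sample_size R (test \<alpha>)"
    unfolding expected_sample_size_def
    by (intro nn_integral_mono) (auto simp: indicator_def)
  finally have "top * emeasure (iid_inf R) {\<omega>\<in>space (iid_inf R). \<not> test \<alpha> \<omega> < \<infinity>} < \<infinity>"
    using assms by (rule order_le_less_trans)
  then have "emeasure (iid_inf R) {\<omega>\<in>space (iid_inf R). \<not> test \<alpha> \<omega> < \<infinity>} = 0"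
    by (auto simp: ennreal_top_mult split: if_splits)
  then have "inf.prob {\<omega>\<in>space (iid_inf R). \<not> test \<alpha> \<omega> < \<infinity>} = 0"
    by (simp add: measure_def)
  then show ?thesis
    unfolding power_one_def using inf.prob_neg[OF test_measurable] by simp
qed

end

end

section \<open>Choice of thresholds and assembly\<close>

text \<open>Pairing each separating function with every threshold \<open>1 / Suc r\<close> makes the slope of the
  rejection boundary part of the countable index.\<close>

lemma countably_separated_imp_separating_family:
  assumes "countably_separated M \<P> \<Q>"
  obtains n h C \<delta> where "separating_family M n h C \<delta>"
    and "\<And>m P. P \<in> \<P> \<Longrightarrow> (\<integral>x. h m x \<partial>iid_pow P (n m)) \<le> 0"
    and "\<And>Q. Q \<in> \<Q> \<Longrightarrow> \<exists>m. \<delta> m < (\<integral>x. h m x \<partial>iid_pow Q (n m))"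
proof -
  obtain n :: "nat \<Rightarrow> nat" and h :: "nat \<Rightarrow> (nat \<Rightarrow> 'a) \<Rightarrow> real" where
      h: "\<And>m. h m \<in> borel_measurable (iid_pow M (n m))"
         "\<And>m. bounded (h m ` space (iid_pow M (n m)))"
         "\<And>m P. P \<in> \<P> \<Longrightarrow> (\<integral>x. h m x \<partial>iid_pow P (n m)) \<le> 0"
         "\<And>Q. Q \<in> \<Q> \<Longrightarrow> \<exists>m. (\<integral>x. h m x \<partial>iid_pow Q (n m)) > 0"
    using assms unfolding countably_separated_def by blast
  have "\<exists>C>0. \<forall>x\<in>space (iid_pow M (n m)). \<bar>h m x\<bar> \<le> C" for m
    using h(2)[of m] unfolding bounded_pos by auto
  then obtain C where C: "\<And>m. C m > 0" "\<And>m x. x \<in> space (iid_pow M (n m)) \<Longrightarrow> \<bar>h m x\<bar> \<le> C m"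
    by metis
  \<comment> \<open>An index j codes a pair: the original function \<open>h (p j)\<close> and the
    number of a threshold.\<close>
  define p :: "nat \<Rightarrow> nat" where "p j = fst (prod_decode j)" for j
  define \<delta> :: "nat \<Rightarrow> real" where "\<delta> j = inverse (real (Suc (snd (prod_decode j))))" for j
  show ?thesis
  proof
    show "separating_family M (n \<circ> p) (h \<circ> p) (C \<circ> p) \<delta>"
      by unfold_locales (use h C in \<open>auto simp: \<delta>_def\<close>)
    show "(\<integral>x. (h \<circ> p) m x \<partial>iid_pow P ((n \<circ> p) m)) \<le> 0" if "P \<in> \<P>" for m P
      using h(3)[OF that] by simp
    fix Q assume "Q \<in> \<Q>"
    then obtain m where "0 < (\<integral>x. h m x \<partial>iid_pow Q (n m))"
      using h(4) by blast
    then obtain r where "inverse (real (Suc r)) < (\<integral>x. h m x \<partial>iid_pow Q (n m))"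
      using reals_Archimedean by blast
    then show "\<exists>j. \<delta> j < (\<integral>x. (h \<circ> p) j x \<partial>iid_pow Q ((n \<circ> p) j))"
      by (intro exI[of _ "prod_encode (m, r)"]) (simp add: p_def \<delta>_def)
  qed
qed

theorem corollary3p2:
  fixes M :: "'a measure" and \<P> \<Q> :: "'a measure set"
  assumes "\<P> \<noteq> {}" and "\<Q> \<noteq> {}"
    and "\<And>P. P \<in> \<P> \<Longrightarrow> prob_space P \<and> sets P = sets M"
    and "\<And>Q. Q \<in> \<Q> \<Longrightarrow> prob_space Q \<and> sets Q = sets M"
    and "sequentially_testable M \<P> \<Q>"
  shows "\<exists>\<tau> :: real \<Rightarrow> (nat \<Rightarrow> 'a) \<Rightarrow> enat.
    (\<forall>\<alpha>\<in>{0<..<1}. sequential_test M (\<tau> \<alpha>) \<and> level \<P> \<alpha> (\<tau> \<alpha>) \<and>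
       (\<forall>Q\<in>\<Q>. power_one Q (\<tau> \<alpha>))) \<and>
    (\<forall>Q\<in>\<Q>. \<exists>A B :: real. \<forall>\<alpha>\<in>{0<..<1}.
       expected_sample_size Q (\<tau> \<alpha>) \<le> ennreal (A + B * ln (1 / \<alpha>))) \<and>
    (\<forall>Q\<in>\<Q>. \<forall>\<alpha>\<in>{0<..<1}. expected_sample_size Q (\<tau> \<alpha>) < \<infinity>)"
proof -
  \<comment> \<open>The universal alternative of testability yields an instance because the interval
    of levels is nonempty.\<close>
  have "\<exists>\<alpha>\<in>{0<..<1::real}. True"
    by (rule bexI[of _ "1 / 2"]) auto
  then have "countably_separated M \<P> \<Q>"
    using assms(5) has_power_one_test_imp_countably_separated[OF assms(3,4)]
    unfolding sequentially_testable_def by auto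
  then obtain n h C \<delta> where fam: "separating_family M n h C \<delta>"
    and P: "\<And>m P. P \<in> \<P> \<Longrightarrow> (\<integral>x. h m x \<partial>iid_pow P (n m)) \<le> 0"
    and Q: "\<And>Q. Q \<in> \<Q> \<Longrightarrow> \<exists>m. \<delta> m < (\<integral>x. h m x \<partial>iid_pow Q (n m))"
    using countably_separated_imp_separating_family by blast
  interpret separating_family M n h C \<delta> by (rule fam)
  have log: "\<exists>A B :: real. \<forall>\<alpha>\<in>{0<..<1}.
      expected_sample_size Q (test \<alpha>) \<le> ennreal (A + B * ln (1 / \<alpha>))" if "Q \<in> \<Q>" for Q
    using expected_sample_size_test_log Q[OF that] assms(4)[OF that] by blast
  \<comment> \<open>The logarithmic bound is a real number, hence finite; this finiteness in turn
    gives power one.\<close>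
  then have fin: "expected_sample_size Q (test \<alpha>) < \<infinity>" if "Q \<in> \<Q>" "\<alpha> \<in> {0<..<1}" for Q \<alpha>
    using that by (metis ennreal_less_top infinity_ennreal_def order_le_less_trans)
  have "level \<P> \<alpha> (test \<alpha>)" if "\<alpha> \<in> {0<..<1}" for \<alpha>
    unfolding level_def using test_level P assms(3) that by auto
  moreover have "power_one Q (test \<alpha>)" if "Q \<in> \<Q>" "\<alpha> \<in> {0<..<1}" for Q \<alpha>
    using power_one_test assms(4)[OF that(1)] fin[OF that] by blast
  ultimately show ?thesis
    using sequential_test_test log fin by blast
qed

end
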